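(* Let $\mathcal F$ be a filter, let $S=\{f_\alpha:\alpha<\mathfrak b(\mathcal F)\}$ be a $\mathfrak b(\mathcal F)$-scale, and let $X=S\cup Q$, viewed as a subspace of $\overline{\mathbb N}^{\uparrow\mathbb N}$. Then for each positive integer $k$ and each continuous $\Psi:X^k\to\mathbb N^{\mathbb N}$, there exist $A_1,\dots,A_k\in\mathcal F^+$ such that $\Psi[X^k]$ is bounded with respect to $\le_{\mathcal F_{A_1}\cup\dots\cup\mathcal F_{A_k}}$.
   Context: $\mathbb N=\{0,1,2,\dots\}$, discrete; $\mathbb N^{\mathbb N}$ has the product topology. $[\mathbb N]^{\aleph_0}$ is the family of infinite subsets of $\mathbb N$; $A\subseteq^*B$ means $A\setminus B$ is finite. A semifilter is a nonempty $\mathcal F\subseteq[\mathbb N]^{\aleph_0}$ such that $A\in\mathcal F$, $B\subseteq\mathbb N$ and $A\subseteq^*B$ imply $B\in\mathcal F$. A filter is a semifilter closed under finite intersections. For $f,g\in\mathbb N^{\mathbb N}$ and a family $\mathcal F\subseteq[\mathbb N]^{\aleph_0}$, $f\le_{\mathcal F}g$ means $\{n:f(n)\le g(n)\}\in\mathcal F$. A set $Y\subseteq\mathbb N^{\mathbb N}$ is bounded with respect to $\le_{\mathcal F}$ if there is $g\in\mathbb N^{\mathbb N}$ with $f\le_{\mathcal F}g$ for all $f\in Y$; otherwise it is unbounded. $\mathfrak b(\mathcal F)$ is the minimal cardinality of a subset of $\mathbb N^{\mathbb N}$ that is unbounded with respect to $\le_{\mathcal F}$. $\mathbb N^{\uparrow\mathbb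 N}$ is the set of (strictly) increasing elements of $\mathbb N^{\mathbb N}$. A $\mathfrak b(\mathcal F)$-scale is a family $S=\{f_\alpha:\alpha<\mathfrak b(\mathcal F)\}\subseteq\mathbb N^{\uparrow\mathbb N}$ that is unbounded with respect to $\le_{\mathcal F}$ and satisfies $f_\alpha\le_{\mathcal F}f_\beta$ for all $\alpha<\beta<\mathfrak b(\mathcal F)$. $\overline{\mathbb N}=\mathbb N\cup\{\infty\}$ is the one-point compactification of $\mathbb N$. $\overline{\mathbb N}^{\uparrow\mathbb N}$ is the subspace of the product $\overline{\mathbb N}^{\mathbb N}$ consisting of the nondecreasing $f$ such that $f(n)<f(n+1)$ whenever $f(n)<\infty$. $Q$ is the (countable) set of all $f\in\overline{\mathbb N}^{\uparrow\mathbb N}$ that take the value $\infty$; thus $\overline{\mathbb N}^{\uparrow\mathbb N}=Q\cup\mathbb N^{\uparrow\mathbb N}$. $\mathcal F^+=\{A\subseteq\mathbb N:\mathbb N\setminus A\notin\mathcal F\}$. For $A\in\mathcal F^+$, $\mathcal F_A=\{C\subseteq\mathbb N:(\exists B\in\mathcal F)\ B\cap A\subseteq C\}$. *)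

theory Defs
  imports "HOL-Analysis.Analysis"
begin

unbundle cardinal_syntax

definition almost_subset :: "nat set \<Rightarrow> nat set \<Rightarrow> bool" (infix \<open>\<subseteq>\<^sup>*\<close> 50)
  where "A \<subseteq>\<^sup>* B \<longleftrightarrow> finite (A - B)"

definition semifilter :: "nat set set \<Rightarrow> bool"
  where "semifilter F \<longleftrightarrow>
    F \<noteq> {} \<and> F \<subseteq> {A. infinite A} \<and> (\<forall>A B. A \<in> F \<longrightarrow> A \<subseteq>\<^sup>* B \<longrightarrow> B \<in> F)"

text \<open>
  Unlike \<^const>\<open>is_filter\<close>, this notion is always proper and contains all cofinite sets.
\<close>
definition set_filter :: "nat set set \<Rightarrow> bool"
  where "set_filter F \<longleftrightarrow> semifilter F \<and> (\<forall>A\<in>F. \<forall>B\<in>F. A \<inter> B \<in> F)"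

definition le_mod :: "nat set set \<Rightarrow> (nat \<Rightarrow> nat) \<Rightarrow> (nat \<Rightarrow> nat) \<Rightarrow> bool"
  where "le_mod F f g \<longleftrightarrow> {n. f n \<le> g n} \<in> F"

definition bounded_mod :: "nat set set \<Rightarrow> (nat \<Rightarrow> nat) set \<Rightarrow> bool"
  where "bounded_mod F Y \<longleftrightarrow> (\<exists>g. \<forall>f\<in>Y. le_mod F f g)"

text \<open>
  A cardinal is represented, as in the library, by a well-order \<open>\<kappa>\<close> of minimal order type for its
  field, that is, by an initial ordinal up to order isomorphism. Its ordinals \<open>\<alpha> < \<kappa>\<close> are the
  elements of \<^term>\<open>Field \<kappa>\<close>. The following says that \<open>\<kappa>\<close> is \<open>\<bb>(F)\<close>, which determines \<open>\<kappa>\<close> up to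
  order isomorphism.
\<close>
definition bounding_number :: "nat set set \<Rightarrow> 'i rel \<Rightarrow> bool"
  where "bounding_number F \<kappa> \<longleftrightarrow>
    Card_order \<kappa> \<and>
    (\<exists>Y. \<not> bounded_mod F Y \<and> ( |Y|, \<kappa>) \<in> ordIso) \<and>
    (\<forall>Y. \<not> bounded_mod F Y \<longrightarrow> \<kappa> \<le>o |Y| )"

definition b_scale :: "nat set set \<Rightarrow> 'i rel \<Rightarrow> ('i \<Rightarrow> nat \<Rightarrow> nat) \<Rightarrow> bool"
  where "b_scale F \<kappa> f \<longleftrightarrow>
    bounding_number F \<kappa> \<and>
    (\<forall>\<alpha>\<in>Field \<kappa>. strict_mono (f \<alpha>)) \<and>
    \<not> bounded_mod F (f ` Field \<kappa>) \<and>
    (\<forall>\<alpha> \<beta>. (\<alpha>, \<beta>) \<in> \<kappa> \<longrightarrow> \<alpha> \<noteq> \<beta> \<longrightarrow> le_mod F (f \<alpha>) (f \<beta>))"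

text \<open>
  The type \<^typ>\<open>enat\<close> carries the order topology, which makes it the one-point compactification of
  the discrete space \<^typ>\<open>nat\<close>; function types carry the product topology.
\<close>
definition ext_increasing :: "(nat \<Rightarrow> enat) set"
  where "ext_increasing = {f. mono f \<and> (\<forall>n. f n < \<infinity> \<longrightarrow> f n < f (Suc n))}"

definition ext_Q :: "(nat \<Rightarrow> enat) set"
  where "ext_Q = {f \<in> ext_increasing. \<exists>n. f n = \<infinity>}"

definition ext_fun :: "(nat \<Rightarrow> nat) \<Rightarrow> nat \<Rightarrow> enat"
  where "ext_fun f = (\<lambda>n. enat (f n))"

definition positive_sets :: "nat set set \<Rightarrow> nat set set"
  where "positive_sets F = {A. - A \<notin> F}"

definition restrict_family :: "nat set set \<Rightarrow> nat set \<Rightarrow> nat set set"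
  where "restrict_family F A = {C. \<exists>B\<in>F. B \<inter> A \<subseteq> C}"

end

theory Submission
  imports Defs
begin

text \<open>
  A limit of points of \<open>X\<close> whose \<open>n\<close>-th values tend to infinity lies in \<open>Q\<close>, hence in \<open>X\<close>. Thus,
  by compactness, for every partial assignment \<open>r\<close> of coordinates there is \<open>g\<close> such that
  \<open>\<Psi> x n \<le> g n\<close> whenever \<open>x\<close> extends \<open>r\<close> and all remaining coordinates exceed \<open>g\<close> at \<open>n\<close>.
  Given a set \<open>Y \<subseteq> X\<close> with fewer than \<open>\<bb>(F)\<close> elements, the functions \<open>g\<close> obtained for all partial
  assignments with values in \<open>Y\<close> have a common bound \<open>h\<close>. Some \<open>f \<alpha>\<close> exceeds \<open>h\<close> on a set
  \<open>A\<close> in \<open>F\<^sup>+\<close>, so \<open>h\<close> bounds \<open>\<Psi> x\<close> with respect to \<open>F\<^sub>A\<close> whenever each coordinate of \<open>x\<close> is in \<open>Y\<close>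
  or has index at least \<open>\<alpha>\<close>. Start from \<open>Q\<close>, add the \<open>f \<beta>\<close> with \<open>\<beta> < \<alpha>\<close> to \<open>Y\<close>, and
  repeat \<open>k\<close> times: for any given \<open>x\<close>, either in one of the steps no coordinate of \<open>x\<close> is newly
  absorbed, or all of its coordinates lie in the last \<open>Y\<close>.
\<close>

section \<open>Filters and the size of unbounded families\<close>

lemma set_filter_Int: "set_filter F \<Longrightarrow> A \<in> F \<Longrightarrow> B \<in> F \<Longrightarrow> A \<inter> B \<in> F"
  by (simp add: set_filter_def)

lemma set_filter_cofinite:
  assumes "set_filter F" "finite (- A)"
  shows "A \<in> F"
proof -
  obtain B where "B \<in> F"
    using assms(1) by (auto simp: set_filter_def semifilter_def)
  moreover have "B \<subseteq>\<^sup>* A"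
    unfolding almost_subset_def by (rule finite_subset[OF _ assms(2)]) auto
  ultimately show ?thesis
    using assms(1) unfolding set_filter_def semifilter_def by blast
qed

lemma set_filter_UNIV: "set_filter F \<Longrightarrow> UNIV \<in> F"
  by (rule set_filter_cofinite) auto

lemma set_filter_INT:
  assumes "set_filter F" "finite I" "\<And>i. i \<in> I \<Longrightarrow> A i \<in> F"
  shows "(\<Inter>i\<in>I. A i) \<in> F"
  using assms(2,3)
  by (induction I rule: finite_induct) (auto intro: set_filter_UNIV set_filter_Int assms(1))

text \<open>The diagonal sum \<open>g\<close> dominates the \<open>i\<close>-th member of
  \<open>Y\<close> from \<open>n = i\<close> on, and a filter contains every cofinite set.\<close>

lemma bounded_mod_countable:
  assumes F: "set_filter F" and Y: "countable Y"
  shows "bounded_mod F Y"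
proof -
  define e where "e = from_nat_into Y"
  define g where "g n = (\<Sum>i\<le>n. e i n)" for n
  have "le_mod F y g" if y: "y \<in> Y" for y
  proof -
    obtain i where i: "e i = y"
      using from_nat_into_surj[OF Y y] by (auto simp: e_def)
    have "y n \<le> g n" if "i \<le> n" for n
      unfolding g_def i[symmetric] by (rule member_le_sum) (use that in auto)
    then have "- {n. y n \<le> g n} \<subseteq> {..<i}"
      by (auto simp: not_le[symmetric])
    then show ?thesis
      unfolding le_mod_def by (intro set_filter_cofinite[OF F]) (rule finite_subset, auto)
  qed
  then show ?thesis
    by (auto simp: bounded_mod_def)
qed

lemma bounding_number_bounded:
  assumes "bounding_number F \<kappa>" "|Z| <o \<kappa>"
  shows "bounded_mod F (h ` Z)"
proof (rule ccontr)
  assume "\<not> bounded_mod F (h ` Z)"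
  then have "\<kappa> \<le>o |h ` Z|"
    using assms(1) by (auto simp: bounding_number_def)
  also have "|h ` Z| \<le>o |Z|"
    by (rule card_of_image)
  finally show False
    using assms(2) not_ordLeq_ordLess by blast
qed

text \<open>Otherwise an unbounded family of size b(F) would inject into a countable set, hence be
  countable and so bounded. This makes Q small enough to start the iteration from.\<close>

lemma bounding_number_countable:
  assumes F: "set_filter F" and \<kappa>: "bounding_number F \<kappa>" and Z: "countable Z"
  shows "|Z| <o \<kappa>"
proof (rule ccontr)
  obtain Y where Y: "\<not> bounded_mod F Y" "( |Y|, \<kappa>) \<in> ordIso"
    using \<kappa> by (auto simp: bounding_number_def)
  assume "\<not> |Z| <o \<kappa>"
  then have "\<kappa> \<le>o |Z|"
    using \<kappa> not_ordLess_iff_ordLeq[OF _ card_of_Well_order] card_order_on_well_order_on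
    unfolding bounding_number_def by blast
  then have "|Y| \<le>o |Z|"
    using Y(2) ordIso_ordLeq_trans by blast
  then obtain u where "inj_on u Y" "u ` Y \<subseteq> Z"
    by (auto simp: card_of_ordLeq[symmetric])
  then have "countable Y"
    using Z countable_image_inj_on countable_subset by metis
  with Y(1) bounded_mod_countable[OF F] show False
    by blast
qed

lemma bounding_number_infinite_Field:
  assumes "set_filter F" "bounding_number F \<kappa>"
  shows "infinite (Field \<kappa>)"
proof
  assume "finite (Field \<kappa>)"
  then have "|Field \<kappa>| <o \<kappa>"
    using bounding_number_countable[OF assms] countable_finite by blast
  moreover have "( |Field \<kappa>|, \<kappa>) \<in> ordIso"
    using assms(2) by (auto simp: bounding_number_def card_of_Field_ordIso)
  ultimately show False
    using not_ordLess_ordIso by blast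
qed

section \<open>Cardinality of finite powers\<close>

lemma card_of_image_ordLess: "|Z| <o r \<Longrightarrow> |h ` Z| <o r"
  by (rule ordLeq_ordLess_trans[OF card_of_image])

lemma card_of_PiE_ordLeq:
  assumes "infinite Z" "finite I"
  shows "|I \<rightarrow>\<^sub>E Z| \<le>o |Z|"
  using assms(2)
proof (induction I rule: finite_induct)
  case empty
  then show ?case
    using assms(1) by (auto intro!: ordLess_imp_ordLeq finite_ordLess_infinite card_of_Well_order
        simp: Field_card_of)
next
  case (insert i I)
  have "|insert i I \<rightarrow>\<^sub>E Z| \<le>o |Z \<times> (I \<rightarrow>\<^sub>E Z)|"
    by (simp add: PiE_insert_eq card_of_image)
  also have "|Z \<times> (I \<rightarrow>\<^sub>E Z)| \<le>o |Z|"
    by (rule card_of_Times_ordLeq_infinite_Field)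
      (use assms(1) insert.IH in \<open>auto simp: Field_card_of card_of_card_order_on card_of_mono1\<close>)
  finally show ?case .
qed

text \<open>Serves to count the partial assignments with values in a small set: a finite set has
  finite powers, and an infinite one absorbs its finite powers.\<close>

lemma card_of_PiE_ordLess:
  assumes "infinite (Field \<kappa>)" "Card_order \<kappa>" "|Z| <o \<kappa>" "finite I"
  shows "|I \<rightarrow>\<^sub>E Z| <o \<kappa>"
proof (cases "finite Z")
  case True
  then have "finite (I \<rightarrow>\<^sub>E Z)"
    using assms(4) by (simp add: finite_PiE)
  then show ?thesis
    by (intro finite_ordLess_infinite)
      (use assms(1,2) in \<open>auto simp: Field_card_of card_of_well_order_on card_order_on_well_order_on\<close>)
next
  case False
  then show ?thesis
    using card_of_PiE_ordLeq assms(3,4) ordLeq_ordLess_trans by blast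
qed

section \<open>Extended increasing functions and their limits\<close>

lemma enat_the: "x \<noteq> \<infinity> \<Longrightarrow> enat (the_enat x) = x"
  by auto

text \<open>A member of Q is infinite from its first infinite value on, so the finite list of values
  before that point determines it.\<close>

lemma countable_ext_Q: "countable ext_Q"
proof -
  define u :: "nat list \<Rightarrow> nat \<Rightarrow> enat"
    where "u xs = (\<lambda>i. if i < length xs then enat (xs ! i) else \<infinity>)" for xs
  have "q \<in> range u" if "q \<in> ext_Q" for q
  proof -
    define m where "m = (LEAST n. q n = \<infinity>)"
    have "\<exists>n. q n = \<infinity>" "mono q"
      using that by (auto simp: ext_Q_def ext_increasing_def)
    then have m: "q m = \<infinity>" and less: "\<And>i. i < m \<Longrightarrow> q i \<noteq> \<infinity>"
      unfolding m_def by (auto intro: LeastI_ex dest: not_less_Least)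
    have ge: "q i = \<infinity>" if "m \<le> i" for i
      using monoD[OF \<open>mono q\<close> that] m by simp
    have "u (map (\<lambda>i. the_enat (q i)) [0..<m]) = q"
      unfolding u_def using less ge by (auto simp: fun_eq_iff enat_the)
    then show ?thesis
      by (metis rangeI)
  qed
  then have "ext_Q \<subseteq> range u"
    by blast
  then show ?thesis
    by (rule countable_subset) auto
qed

lemma enat_tendsto_finite:
  fixes s :: "nat \<Rightarrow> enat"
  assumes "s \<longlonglongrightarrow> l" "l \<noteq> \<infinity>"
  shows "\<forall>\<^sub>F m in sequentially. s m = l"
proof -
  have "\<forall>\<^sub>F m in sequentially. s m \<in> {l}"
    by (rule topological_tendstoD[OF assms(1)]) (use assms(2) open_enat in auto)
  then show ?thesis
    by simp
qed

lemma ext_increasing_limit: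
  assumes s: "\<And>m. s m \<in> ext_increasing" and l: "\<And>i. (\<lambda>m. s m i) \<longlonglongrightarrow> l i"
  shows "l \<in> ext_increasing"
proof -
  have mono: "s m i \<le> s m j" if "i \<le> j" for m i j
    using s[of m] that by (auto simp: ext_increasing_def mono_def)
  have "mono l"
    unfolding mono_def by (intro allI impI LIMSEQ_le[OF l l]) (use mono in auto)
  moreover have "l n < l (Suc n)" if "l n < \<infinity>" for n
  proof -
    have "\<forall>\<^sub>F m in sequentially. s m n = l n"
      using enat_tendsto_finite[OF l] that by auto
    \<comment> \<open>Strict inequalities may be lost in a limit. Since \<open>s m n\<close> has
      settled at the isolated point \<open>l n\<close>, the strict increase becomes a weak
      inequality with a fixed left side, which survives.\<close>
    then have "\<forall>\<^sub>F m in sequentially. eSuc (l n) \<le> s m (Suc n)"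
    proof (rule eventually_mono)
      fix m
      assume "s m n = l n"
      moreover have "s m n < s m (Suc n)"
        using s[of m] that \<open>s m n = l n\<close> unfolding ext_increasing_def by fastforce
      ultimately show "eSuc (l n) \<le> s m (Suc n)"
        by (simp add: ileI1)
    qed
    then have "eSuc (l n) \<le> l (Suc n)"
      by (intro tendsto_lowerbound[OF l]) auto
    then show ?thesis
      using that by (cases "l n") (auto simp: eSuc_enat Suc_ile_eq)
  qed
  ultimately show ?thesis
    by (simp add: ext_increasing_def)
qed

section \<open>Convergence and compactness in products\<close>

lemma tendsto_fun_iff:
  fixes s :: "'c \<Rightarrow> 'a \<Rightarrow> 'b::topological_space"
  shows "(s \<longlongrightarrow> l) A \<longleftrightarrow> (\<forall>i. ((\<lambda>c. s c i) \<longlongrightarrow> l i) A)"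
  using limitin_componentwise[of "\<lambda>_. euclidean" UNIV s l A]
  by (simp add: euclidean_product_topology)

lemma compact_UNIV_fun:
  assumes "compact (UNIV :: 'b::topological_space set)"
  shows "compact (UNIV :: ('a \<Rightarrow> 'b) set)"
proof -
  have "compact_space (product_topology (\<lambda>_::'a. euclidean :: 'b topology) UNIV)"
    unfolding compact_space_product_topology using assms by (simp add: compact_space_def)
  then show ?thesis
    by (simp add: euclidean_product_topology compact_space_def)
qed

text \<open>The product is compact, and first countable because it has countably many factors. One
  subsequence thus serves all coordinates of a tuple.\<close>

lemma seq_compact_fun_fun_enat: "seq_compact (UNIV :: (nat \<Rightarrow> nat \<Rightarrow> enat) set)"
  by (intro compact_imp_seq_compact compact_UNIV_fun compact_UNIV)

lemma limitin_tuple: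
  fixes y :: "nat \<Rightarrow> nat \<Rightarrow> nat \<Rightarrow> enat"
  assumes y: "\<And>m. y m \<in> I \<rightarrow>\<^sub>E X" and l: "l \<in> I \<rightarrow>\<^sub>E X"
    and lim: "\<And>i. i \<in> I \<Longrightarrow> (\<lambda>m. y m i) \<longlonglongrightarrow> l i"
  shows "limitin (product_topology (\<lambda>_. top_of_set X) I) y l sequentially"
  using assms by (auto simp: limitin_componentwise limitin_subtopology PiE_iff)

text \<open>For fixed \<open>n\<close>, counterexamples to every \<open>N\<close> have a convergent
  subsequence. Assigned coordinates are constant along it and the others become infinite at
  \<open>n\<close>, so the limit is again a tuple in \<open>X\<close>; continuity there contradicts
  the growth of \<open>\<Psi>\<close> at \<open>n\<close>. The one number \<open>g n\<close> is both
  threshold and bound.\<close>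

lemma continuous_bound_near_Q:
  fixes \<Psi> :: "(nat \<Rightarrow> nat \<Rightarrow> enat) \<Rightarrow> nat \<Rightarrow> nat" and r :: "nat \<Rightarrow> (nat \<Rightarrow> enat) option"
  assumes X: "ext_Q \<subseteq> X" "X \<subseteq> ext_increasing"
    and \<Psi>: "continuous_map (product_topology (\<lambda>_. top_of_set X) I) euclidean \<Psi>"
  shows "\<exists>g. \<forall>x\<in>I \<rightarrow>\<^sub>E X. \<forall>n.
    (\<forall>i\<in>I. r i = Some (x i) \<or> r i = None \<and> enat (g n) < x i n) \<longrightarrow> \<Psi> x n \<le> g n"
proof -
  have "\<exists>N. \<forall>x\<in>I \<rightarrow>\<^sub>E X.
    (\<forall>i\<in>I. r i = Some (x i) \<or> r i = None \<and> enat N < x i n) \<longrightarrow> \<Psi> x n \<le> N" for n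
  proof (rule ccontr)
    assume "\<not> ?thesis"
    then obtain y where y: "\<And>N. y N \<in> I \<rightarrow>\<^sub>E X"
      and r: "\<And>N i. i \<in> I \<Longrightarrow> r i = Some (y N i) \<or> r i = None \<and> enat N < y N i n"
      and big: "\<And>N. N < \<Psi> (y N) n"
      unfolding not_ex not_all Ball_def not_imp not_le by metis
    obtain l0 \<sigma> where \<sigma>: "strict_mono \<sigma>" and "(y \<circ> \<sigma>) \<longlonglongrightarrow> l0"
      using seq_compactE[OF seq_compact_fun_fun_enat] by (metis UNIV_I)
    then have lim0: "(\<lambda>m. y (\<sigma> m) i j) \<longlonglongrightarrow> l0 i j" for i j
      by (auto simp: tendsto_fun_iff o_def)
    \<comment> \<open>Tuples over \<open>I\<close> are \<open>undefined\<close> elsewhere;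
      restricting gives the limit that form.\<close>
    define l where "l = restrict l0 I"
    have lim: "(\<lambda>m. y (\<sigma> m) i j) \<longlonglongrightarrow> l i j" if "i \<in> I" for i j
      using lim0 that by (simp add: l_def)
    have lX: "l i \<in> X" if i: "i \<in> I" for i
    proof (cases "r i")
      case None
      \<comment> \<open>A finite limit would eventually be attained, yet the values exceed
        \<open>\<sigma> m\<close>, which is at least \<open>m\<close>.\<close>
      have "l i n = \<infinity>"
      proof (rule ccontr)
        assume fin: "l i n \<noteq> \<infinity>"
        then obtain v where v: "l i n = enat v" by auto
        have "\<forall>\<^sub>F m in sequentially. y (\<sigma> m) i n = l i n"
          by (rule enat_tendsto_finite[OF lim[OF i] fin])
        then have "\<forall>\<^sub>F m in sequentially. y (\<sigma> m) i n = l i n \<and> v \<le> m"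
          using eventually_ge_at_top eventually_conj by blast
        then obtain m where m: "y (\<sigma> m) i n = l i n" "v \<le> m"
          using eventually_happens trivial_limit_sequentially by blast
        have "enat (\<sigma> m) < enat v"
          using r[OF i, of "\<sigma> m"] None m v by auto
        with m(2) seq_suble[OF \<sigma>, of m] show False
          by simp
      qed
      moreover have "l i \<in> ext_increasing"
        by (rule ext_increasing_limit[OF _ lim[OF i]]) (use y X i in blast)
      ultimately show ?thesis
        using X(1) by (auto simp: ext_Q_def)
    next
      case (Some z)
      then have yz: "y m i = z" for m
        using r[OF i, of m] by auto
      have "l i j = z j" for j
        using lim[OF i, of j] by (auto simp: yz LIMSEQ_const_iff)
      then have "l i = y 0 i"
        by (simp add: yz fun_eq_iff)
      then show ?thesis
        using y i by auto
    qed
    have "limitin (product_topology (\<lambda>_. top_of_set X) I) (y \<circ> \<sigma>) l sequentially"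
    proof (rule limitin_tuple)
      show "l \<in> I \<rightarrow>\<^sub>E X"
        using lX by (auto simp: l_def)
    qed (use y lim in \<open>auto simp: tendsto_fun_iff\<close>)
    then have "(\<Psi> \<circ> (y \<circ> \<sigma>)) \<longlonglongrightarrow> \<Psi> l"
      using continuous_map_limit[OF \<Psi>] by simp
    then have "(\<lambda>m. \<Psi> (y (\<sigma> m)) n) \<longlonglongrightarrow> \<Psi> l n"
      by (simp add: o_def tendsto_fun_iff)
    \<comment> \<open>\<open>nat\<close> is discrete, so the convergent values are eventually
      constant, although they exceed \<open>\<sigma> m\<close>.\<close>
    then have "\<forall>\<^sub>F m in sequentially. \<Psi> (y (\<sigma> m)) n = \<Psi> l n"
      by (simp add: tendsto_discrete)
    then have "\<forall>\<^sub>F m in sequentially. \<Psi> (y (\<sigma> m)) n = \<Psi> l n \<and> \<Psi> l n \<le> m"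
      using eventually_ge_at_top eventually_conj by blast
    then obtain m where m: "\<Psi> (y (\<sigma> m)) n = \<Psi> l n" "\<Psi> l n \<le> m"
      using eventually_happens trivial_limit_sequentially by blast
    with big[of "\<sigma> m"] seq_suble[OF \<sigma>, of m] show False
      by simp
  qed
  then show ?thesis
    by metis
qed

text \<open>Each strict inclusion adds an element. Applied to the sets of absorbed coordinates, it
  shows that k strict steps exhaust all k coordinates.\<close>

lemma strictly_growing_subsets_card:
  fixes S :: "nat \<Rightarrow> 'a set"
  assumes "\<And>j. S j \<subseteq> S (Suc j)" "\<And>j. finite (S j)" "\<And>j. j < k \<Longrightarrow> S j \<noteq> S (Suc j)" "j \<le> k"
  shows "j \<le> card (S j)"
  using assms(4)
proof (induction j)
  case (Suc j)
  then have "card (S j) < card (S (Suc j))"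
    using assms(1,2,3)[of j] assms(2) by (intro psubset_card_mono) auto
  with Suc show ?case
    by simp
qed simp

lemma ext_fun_in_ext_increasing: "strict_mono f \<Longrightarrow> ext_fun f \<in> ext_increasing"
  by (auto simp: ext_increasing_def ext_fun_def strict_mono_def mono_def less_imp_le strict_mono_less_eq)

section \<open>Iterated absorption of initial segments of the scale\<close>

theorem theorem4p1:
  fixes F :: "nat set set"
    and \<kappa> :: "'i rel"
    and f :: "'i \<Rightarrow> nat \<Rightarrow> nat"
    and X :: "(nat \<Rightarrow> enat) set"
    and k :: nat
    and \<Psi> :: "(nat \<Rightarrow> nat \<Rightarrow> enat) \<Rightarrow> nat \<Rightarrow> nat"
  assumes "set_filter F"
    and "b_scale F \<kappa> f"
    and "X = ext_fun ` (f ` Field \<kappa>) \<union> ext_Q"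
    and "0 < k"
    and "continuous_map (product_topology (\<lambda>_. top_of_set X) {1..k}) euclidean \<Psi>"
  shows "\<exists>A :: nat \<Rightarrow> nat set. (\<forall>i\<in>{1..k}. A i \<in> positive_sets F) \<and>
    bounded_mod (\<Union>i\<in>{1..k}. restrict_family F (A i)) (\<Psi> ` ({1..k} \<rightarrow>\<^sub>E X))"
proof -
  note F = assms(1)
  have \<kappa>: "bounding_number F \<kappa>" "Card_order \<kappa>" and inf: "infinite (Field \<kappa>)"
    and unb: "\<not> bounded_mod F (f ` Field \<kappa>)"
    and incr: "\<And>\<alpha>. \<alpha> \<in> Field \<kappa> \<Longrightarrow> strict_mono (f \<alpha>)"
    and scale: "\<And>\<alpha> \<beta>. (\<alpha>, \<beta>) \<in> \<kappa> \<Longrightarrow> \<alpha> \<noteq> \<beta> \<Longrightarrow> le_mod F (f \<alpha>) (f \<beta>)"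
    using assms(2) bounding_number_infinite_Field[OF F]
    by (auto simp: b_scale_def bounding_number_def)
  have lin: "(\<alpha>, \<beta>) \<in> \<kappa>" if "\<alpha> \<in> Field \<kappa>" "\<beta> \<in> Field \<kappa>" "\<beta> \<notin> underS \<kappa> \<alpha>" for \<alpha> \<beta>
  proof -
    have "Linear_order \<kappa>"
      using card_order_on_well_order_on[OF \<kappa>(2)] by (simp add: well_order_on_def)
    then show ?thesis
      using that by (cases "\<alpha> = \<beta>") (auto simp: underS_def order_on_defs total_on_def dest: refl_onD)
  qed
  have X: "ext_Q \<subseteq> X" "X \<subseteq> ext_increasing"
    using assms(3) incr ext_fun_in_ext_increasing by (auto simp: ext_Q_def)

  \<comment> \<open>\<open>None\<close> marks an unassigned coordinate, so partial assignments form
    a finite power, whose size can be bounded.\<close>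
  define partial :: "(nat \<Rightarrow> enat) set \<Rightarrow> (nat \<Rightarrow> (nat \<Rightarrow> enat) option) set"
    where "partial Y = {1..k} \<rightarrow>\<^sub>E insert None (Some ` Y)" for Y
  obtain G where G: "\<And>r x n. x \<in> {1..k} \<rightarrow>\<^sub>E X \<Longrightarrow>
      (\<And>i. i \<in> {1..k} \<Longrightarrow> r i = Some (x i) \<or> r i = None \<and> enat (G r n) < x i n) \<Longrightarrow> \<Psi> x n \<le> G r n"
    using continuous_bound_near_Q[OF X assms(5)] by metis
  have bound: "\<exists>h. \<forall>r\<in>partial Y. le_mod F (G r) h" if "|Y| <o \<kappa>" for Y
  proof -
    have "|Some ` Y| <o \<kappa>"
      by (rule card_of_image_ordLess[OF that])
    moreover have "|{None :: (nat \<Rightarrow> enat) option}| <o \<kappa>"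
      by (rule bounding_number_countable[OF F \<kappa>(1)]) simp
    ultimately have "|{None} \<union> Some ` Y| <o \<kappa>"
      by (rule card_of_Un_ordLess_infinite_Field[OF inf \<kappa>(2), rotated])
    then have "|partial Y| <o \<kappa>"
      unfolding partial_def by (intro card_of_PiE_ordLess[OF inf \<kappa>(2)]) auto
    then show ?thesis
      using bounding_number_bounded[OF \<kappa>(1)] unfolding bounded_mod_def by blast
  qed
  \<comment> \<open>One function bounds all \<open>G r\<close> at once, as there are fewer than b(F)
    partial assignments with values in \<open>Y\<close>.\<close>
  then obtain H where H: "\<And>Y r. |Y| <o \<kappa> \<Longrightarrow> r \<in> partial Y \<Longrightarrow> le_mod F (G r) (H Y)"
    by metis
  have "\<exists>\<alpha>\<in>Field \<kappa>. \<not> le_mod F (f \<alpha>) h" for h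
    using unb by (auto simp: bounded_mod_def)
  then obtain \<alpha> where \<alpha>: "\<And>h. \<alpha> h \<in> Field \<kappa>" "\<And>h. \<not> le_mod F (f (\<alpha> h)) h"
    by metis
  \<comment> \<open>\<open>\<alpha> (H Y)\<close> indexes a scale member not bounded by
    \<open>H Y\<close>. The indices strictly below it form a proper initial segment, smaller than
    b(F); scale members left out lie above \<open>f (\<alpha> (H Y))\<close> modulo F.\<close>
  define next_set where "next_set Y = Y \<union> ext_fun ` f ` underS \<kappa> (\<alpha> (H Y))" for Y
  define Y where "Y j = (next_set ^^ j) ext_Q" for j
  have Y_Suc: "Y (Suc j) = next_set (Y j)" for j
    by (simp add: Y_def)
  have small: "|Y j| <o \<kappa>" for j
  proof (induction j)
    case 0
    then show ?case
      by (simp add: Y_def bounding_number_countable[OF F \<kappa>(1) countable_ext_Q])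
  next
    case (Suc j)
    have "|underS \<kappa> (\<alpha> (H (Y j)))| <o \<kappa>"
      by (rule card_of_underS[OF \<kappa>(2) \<alpha>(1)])
    then have "|ext_fun ` f ` underS \<kappa> (\<alpha> (H (Y j)))| <o \<kappa>"
      by (intro card_of_image_ordLess)
    with Suc show ?case
      unfolding Y_Suc next_set_def by (rule card_of_Un_ordLess_infinite_Field[OF inf \<kappa>(2)])
  qed
  \<comment> \<open>Stages count from 0 but the sets of the theorem from 1, so
    \<open>A (Suc j)\<close> belongs to \<open>Y j\<close>.\<close>
  define A where "A j = {n. H (Y (j - 1)) n < f (\<alpha> (H (Y (j - 1)))) n}" for j
  have A: "A j \<in> positive_sets F" for j
  proof -
    have "- A j = {n. f (\<alpha> (H (Y (j - 1)))) n \<le> H (Y (j - 1)) n}"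
      by (auto simp: A_def)
    then show ?thesis
      using \<alpha>(2) by (auto simp: positive_sets_def le_mod_def)
  qed
  \<comment> \<open>If no coordinate of \<open>x\<close> is newly absorbed, those outside
    \<open>Y j\<close> are scale members of index at least
    \<open>\<alpha> (H (Y j))\<close>.\<close>
  have stage: "{n. \<Psi> x n \<le> H (Y j) n} \<in> restrict_family F (A (Suc j))"
    if x: "x \<in> {1..k} \<rightarrow>\<^sub>E X" and eq: "\<And>i. i \<in> {1..k} \<Longrightarrow> x i \<in> Y (Suc j) \<Longrightarrow> x i \<in> Y j" for x j
  proof -
    define r where "r = (\<lambda>i\<in>{1..k}. if x i \<in> Y j then Some (x i) else None)"
    define a where "a = \<alpha> (H (Y j))"
    have "r \<in> partial (Y j)"
      by (auto simp: r_def partial_def)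
    then have B1: "{n. G r n \<le> H (Y j) n} \<in> F"
      using H[OF small] by (simp add: le_mod_def)
    define C where "C i = {n. x i \<in> Y j \<or> enat (f a n) \<le> x i n}" for i
    have C: "C i \<in> F" if i: "i \<in> {1..k}" for i
    proof (cases "x i \<in> Y j")
      case True
      then show ?thesis
        using set_filter_UNIV[OF F] by (simp add: C_def)
    next
      case False
      then have "x i \<notin> Y (Suc j)"
        using eq i by blast
      have "x i \<notin> ext_Q"
      proof
        assume "x i \<in> ext_Q"
        moreover have "ext_Q \<subseteq> Y j"
          by (induction j) (auto simp: Y_def next_set_def)
        ultimately show False
          using False by blast
      qed
      moreover have "x i \<in> X"
        using x i by (rule PiE_mem)
      ultimately obtain \<beta> where \<beta>: "\<beta> \<in> Field \<kappa>" "x i = ext_fun (f \<beta>)"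
        unfolding assms(3) by blast
      then have "\<beta> \<notin> underS \<kappa> a"
        using \<open>x i \<notin> Y (Suc j)\<close> by (auto simp: Y_Suc next_set_def a_def)
      then have "(a, \<beta>) \<in> \<kappa>"
        using lin \<alpha>(1) \<beta>(1) by (simp add: a_def)
      then have "le_mod F (f a) (f \<beta>)"
        using scale[of a \<beta>] set_filter_UNIV[OF F] by (cases "a = \<beta>") (auto simp: le_mod_def)
      then show ?thesis
        using False by (simp add: C_def \<beta> ext_fun_def le_mod_def)
    qed
    let ?B = "{n. G r n \<le> H (Y j) n} \<inter> (\<Inter>i\<in>{1..k}. C i)"
    have "?B \<in> F"
      by (intro set_filter_Int[OF F] B1 set_filter_INT[OF F] C) auto
    \<comment> \<open>For \<open>x i\<close> outside \<open>Y j\<close>, the chain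
      \<open>G r n \<le> H (Y j) n < f a n \<le> x i n\<close> verifies the condition under which
      \<open>G r n\<close> bounds \<open>\<Psi> x n\<close>.\<close>
    moreover have "\<Psi> x n \<le> H (Y j) n" if n: "n \<in> ?B" "n \<in> A (Suc j)" for n
    proof -
      have "\<Psi> x n \<le> G r n"
      proof (rule G[OF x])
        fix i
        assume i: "i \<in> {1..k}"
        show "r i = Some (x i) \<or> r i = None \<and> enat (G r n) < x i n"
        proof (cases "x i \<in> Y j")
          case False
          then have "enat (f a n) \<le> x i n"
            using n i by (auto simp: C_def)
          moreover have "G r n < f a n"
            using n by (auto simp: A_def a_def)
          ultimately have "enat (G r n) < x i n"
            using enat_ord_simps(2) less_le_trans by blast
          then show ?thesis
            using False i by (simp add: r_def)
        qed (use i in \<open>simp add: r_def\<close>)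
      qed
      also have "\<dots> \<le> H (Y j) n"
        using n by simp
      finally show ?thesis .
    qed
    ultimately show ?thesis
      unfolding restrict_family_def by blast
  qed
  \<comment> \<open>The sum majorizes the bounds of the k stages and that of the final set
    \<open>Y k\<close>.\<close>
  define h where "h n = (\<Sum>j\<le>k. H (Y j) n)" for n
  have h: "H (Y j) n \<le> h n" if "j \<le> k" for j n
    unfolding h_def by (rule member_le_sum) (use that in auto)
  have mono: "C' \<in> restrict_family F A'" if "C \<in> restrict_family F A'" "C \<subseteq> C'" for C C' A'
    using that unfolding restrict_family_def by blast
  have "le_mod (\<Union>i\<in>{1..k}. restrict_family F (A i)) (\<Psi> x) h" if x: "x \<in> {1..k} \<rightarrow>\<^sub>E X" for x
  proof -
    define S where "S j = {i \<in> {1..k}. x i \<in> Y j}" for j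
    show ?thesis
    proof (cases "\<exists>j<k. S j = S (Suc j)")
      case True
      then obtain j where j: "j < k" "S j = S (Suc j)"
        by blast
      then have "x i \<in> Y j" if "i \<in> {1..k}" "x i \<in> Y (Suc j)" for i
        using that unfolding S_def by blast
      then have "{n. \<Psi> x n \<le> H (Y j) n} \<in> restrict_family F (A (Suc j))"
        by (rule stage[OF x])
      then have "{n. \<Psi> x n \<le> h n} \<in> restrict_family F (A (Suc j))"
        by (rule mono) (use j(1) in \<open>auto intro: le_trans[OF _ h]\<close>)
      moreover have "Suc j \<in> {1..k}"
        using j by simp
      ultimately show ?thesis
        unfolding le_mod_def by blast
    next
      case False
      have "k \<le> card (S k)"
        by (rule strictly_growing_subsets_card[where k = k])
          (use False in \<open>auto simp: S_def Y_Suc next_set_def\<close>)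
      then have "S k = {1..k}"
        by (intro card_seteq) (auto simp: S_def)
      then have xY: "x i \<in> Y k" if "i \<in> {1..k}" for i
        using that unfolding S_def by blast
      \<comment> \<open>With every coordinate assigned there is no threshold to exceed, so
        \<open>G r\<close> bounds \<open>\<Psi> x\<close> everywhere.\<close>
      define r where "r = (\<lambda>i\<in>{1..k}. Some (x i))"
      have "r \<in> partial (Y k)"
        using xY by (auto simp: r_def partial_def)
      then have "{n. G r n \<le> H (Y k) n} \<in> F"
        using H[OF small] by (simp add: le_mod_def)
      moreover have "\<Psi> x n \<le> G r n" for n
        by (rule G[OF x]) (simp add: r_def)
      then have "{n. G r n \<le> H (Y k) n} \<subseteq> {n. \<Psi> x n \<le> h n}"
        using h[of k] by (intro Collect_mono impI) (blast intro: le_trans)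
      \<comment> \<open>F is contained in each of its restrictions; the index 1 is available because
        \<open>k\<close> is positive.\<close>
      ultimately have "{n. \<Psi> x n \<le> h n} \<in> restrict_family F (A 1)"
        unfolding restrict_family_def by blast
      then show ?thesis
        unfolding le_mod_def using assms(4) by (intro UN_I[of 1]) auto
    qed
  qed
  then have "bounded_mod (\<Union>i\<in>{1..k}. restrict_family F (A i)) (\<Psi> ` ({1..k} \<rightarrow>\<^sub>E X))"
    unfolding bounded_mod_def by blast
  with A show ?thesis
    by (intro exI[of _ A] conjI ballI)
qed

end
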